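(* Let $\mathcal{C}$ be a permutation class. The following are equivalent. (1) There exists a $\mathsf{TOTO}$ formula $\phi(x,y)$ such that for every $\sigma\in\mathcal{C}$ and every pair $(a,b)$ of elements of $\sigma$, $(\sigma,a,b)\models\phi(x,y)$ if and only if $(a,b)$ is a transposition of $\sigma$. (2) There exist integers $k\ge2$, $m\ge1$, $n\ge1$ such that neither $\delta_k$ nor $\iota_m\ominus\iota_n$ belongs to $\mathcal{C}$.
   Context: A permutation $\sigma$ of size $N$ is identified with the finite structure with domain $A^\sigma=\{(i,\sigma(i)) : 1\le i\le N\}$, position order $<_P$ (comparing first coordinates) and value order $<_V$ (comparing second coordinates); $\mathsf{TOTO}$ is first-order logic with equality over $\{<_P,<_V\}$. A pair $(a,b)=((i,\sigma(i)),(j,\sigma(j)))$ is a transposition of $\sigma$ if $i\ne j$, $\sigma(i)=j$ and $\sigma(j)=i$. A permutation class is a set of permutations closed under taking patterns. $\iota_n=12\cdots n$, $\delta_k=k\cdots21$, and $\iota_m\ominus\iota_n=21[\iota_m,\iota_n]$ is the permutation $(n+1)(n+2)\cdots(n+m)\,1\,2\cdots n$. *)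

theory Defs
  imports Main "HOL-Combinatorics.Permutations"
begin

text \<open>A permutation of size \<open>N\<close> is a pair \<open>(N, s)\<close> with \<open>s permutes {1..N}\<close>. The size is
  kept explicitly because \<open>s\<close> alone does not determine it; as \<open>s\<close> is the identity outside
  \<open>{1..N}\<close>, equality of such pairs is equality of permutations. The empty permutation
  (\<open>N = 0\<close>) is allowed.\<close>

type_synonym perm = "nat \<times> (nat \<Rightarrow> nat)"

definition is_perm :: "perm \<Rightarrow> bool" where
  "is_perm \<sigma> \<longleftrightarrow> snd \<sigma> permutes {1..fst \<sigma>}"

definition is_pattern_of :: "perm \<Rightarrow> perm \<Rightarrow> bool" where
  "is_pattern_of \<pi> \<sigma> \<longleftrightarrow>
    (\<exists>f. f ` {1..fst \<pi>} \<subseteq> {1..fst \<sigma>} \<and> strict_mono_on {1..fst \<pi>} f \<and>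
      (\<forall>i\<in>{1..fst \<pi>}. \<forall>j\<in>{1..fst \<pi>}.
        snd \<pi> i < snd \<pi> j \<longleftrightarrow> snd \<sigma> (f i) < snd \<sigma> (f j)))"

definition perm_class :: "perm set \<Rightarrow> bool" where
  "perm_class C \<longleftrightarrow>
    (\<forall>\<sigma>\<in>C. is_perm \<sigma>) \<and>
    (\<forall>\<sigma>\<in>C. \<forall>\<pi>. is_perm \<pi> \<and> is_pattern_of \<pi> \<sigma> \<longrightarrow> \<pi> \<in> C)"

definition iota :: "nat \<Rightarrow> perm" where
  "iota n = (n, id)"

definition delta :: "nat \<Rightarrow> perm" where
  "delta k = (k, \<lambda>i. if i \<in> {1..k} then k + 1 - i else i)"

definition skew_sum :: "perm \<Rightarrow> perm \<Rightarrow> perm" (infixl "\<ominus>" 65) where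
  "\<sigma> \<ominus> \<tau> = (fst \<sigma> + fst \<tau>,
     \<lambda>i. if i \<in> {1..fst \<sigma>} then fst \<tau> + snd \<sigma> i
         else if i \<in> {fst \<sigma> + 1..fst \<sigma> + fst \<tau>} then snd \<tau> (i - fst \<sigma>)
         else i)"

lemma is_perm_iota: "is_perm (iota n)"
  by (simp add: is_perm_def iota_def permutes_id)

lemma is_perm_delta: "is_perm (delta k)"
proof -
  have "bij_betw (snd (delta k)) {1..k} {1..k}"
    by (rule bij_betw_byWitness[where f' = "snd (delta k)"]) (auto simp: delta_def)
  then show ?thesis
    unfolding is_perm_def by (auto simp: delta_def intro!: bij_imp_permutes)
qed

lemma is_perm_iota_skew_sum_iota: "is_perm (iota m \<ominus> iota n)"
proof -
  have "bij_betw (snd (iota m \<ominus> iota n)) {1..m + n} {1..m + n}"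
    by (rule bij_betw_byWitness[where f' = "snd (iota n \<ominus> iota m)"])
      (auto simp: skew_sum_def iota_def)
  then show ?thesis
    unfolding is_perm_def by (auto simp: skew_sum_def iota_def intro!: bij_imp_permutes)
qed

datatype toto =
    Eq nat nat
  | LessP nat nat
  | LessV nat nat
  | Neg toto
  | Conj toto toto
  | Ex nat toto

fun free_vars :: "toto \<Rightarrow> nat set" where
  "free_vars (Eq x y) = {x, y}"
| "free_vars (LessP x y) = {x, y}"
| "free_vars (LessV x y) = {x, y}"
| "free_vars (Neg \<phi>) = free_vars \<phi>"
| "free_vars (Conj \<phi> \<psi>) = free_vars \<phi> \<union> free_vars \<psi>"
| "free_vars (Ex x \<phi>) = free_vars \<phi> - {x}"

definition elems :: "perm \<Rightarrow> (nat \<times> nat) set" where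
  "elems \<sigma> = {(i, snd \<sigma> i) | i. i \<in> {1..fst \<sigma>}}"

fun sat :: "perm \<Rightarrow> (nat \<Rightarrow> nat \<times> nat) \<Rightarrow> toto \<Rightarrow> bool" where
  "sat \<sigma> v (Eq x y) \<longleftrightarrow> v x = v y"
| "sat \<sigma> v (LessP x y) \<longleftrightarrow> fst (v x) < fst (v y)"
| "sat \<sigma> v (LessV x y) \<longleftrightarrow> snd (v x) < snd (v y)"
| "sat \<sigma> v (Neg \<phi>) \<longleftrightarrow> \<not> sat \<sigma> v \<phi>"
| "sat \<sigma> v (Conj \<phi> \<psi>) \<longleftrightarrow> sat \<sigma> v \<phi> \<and> sat \<sigma> v \<psi>"
| "sat \<sigma> v (Ex x \<phi>) \<longleftrightarrow> (\<exists>a\<in>elems \<sigma>. sat \<sigma> (v(x := a)) \<phi>)"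

text \<open>A formula \<open>\<phi>(x, y)\<close> has its free variables among \<open>0\<close> (for \<open>x\<close>) and \<open>1\<close> (for \<open>y\<close>).
  For such formulas the value given to the other variables is irrelevant.\<close>

definition binary_formula :: "toto \<Rightarrow> bool" where
  "binary_formula \<phi> \<longleftrightarrow> free_vars \<phi> \<subseteq> {0, 1}"

definition sat2 :: "perm \<Rightarrow> nat \<times> nat \<Rightarrow> nat \<times> nat \<Rightarrow> toto \<Rightarrow> bool" where
  "sat2 \<sigma> a b \<phi> \<longleftrightarrow> sat \<sigma> ((\<lambda>_. b)(0 := a)) \<phi>"

definition is_transposition :: "perm \<Rightarrow> nat \<times> nat \<Rightarrow> nat \<times> nat \<Rightarrow> bool" where
  "is_transposition \<sigma> a b \<longleftrightarrow>
    (\<exists>i\<in>{1..fst \<sigma>}. \<exists>j\<in>{1..fst \<sigma>}. a = (i, snd \<sigma> i) \<and> b = (j, snd \<sigma> j) \<and>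
      i \<noteq> j \<and> snd \<sigma> i = j \<and> snd \<sigma> j = i)"

end

theory Submission
  imports Defs "HOL-Library.Ramsey"
begin

text \<open>For elements \<open>a\<close> and \<open>b\<close>, the value of \<open>a\<close> equals the position of \<open>b\<close> iff the points that
  are not right of \<open>b\<close> and above \<open>a\<close> are as many as the points that are right of \<open>b\<close> and not above \<open>a\<close>.
  If both sets were large, Ramsey's theorem would produce a \<open>\<delta>\<^sub>k\<close> or an \<open>\<iota>\<^sub>m \<ominus> \<iota>\<^sub>n\<close>; so if
  these are excluded it suffices to compare the two counts up to a fixed bound, which is first-order.
  Conversely, a formula of quantifier rank \<open>r\<close> sees distances in a linear order only up to \<open>2 ^ r\<close>.
  Hence in a long \<open>\<delta>\<^sub>k\<close> it cannot tell the partner of a point in a transposition from the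
  neighbour of that partner, and it cannot tell \<open>\<iota>\<^sub>n \<ominus> \<iota>\<^sub>n\<close>, where \<open>(1, n + 1)\<close> and
  \<open>(n + 1, 1)\<close> form a transposition, from \<open>\<iota>\<^sub>n \<ominus> \<iota>\<^sub>n\<^sub>+\<^sub>1\<close>, which has none.\<close>

section \<open>Counting formulas\<close>

lemma finite_elems: "finite (elems \<sigma>)"
proof -
  have "elems \<sigma> = (\<lambda>i. (i, snd \<sigma> i)) ` {1..fst \<sigma>}"
    by (auto simp: elems_def)
  then show ?thesis by simp
qed

lemma inj_on_fst_elems: "inj_on fst (elems \<sigma>)"
  by (auto simp: inj_on_def elems_def)

text \<open>The recursion behind the counting formulas. The element of \<open>T\<close> with least
  first coordinate serves as witness \<open>a\<close>: by injectivity of \<open>fst\<close>, all the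
  rest of \<open>T\<close> lies strictly after it.\<close>

lemma Suc_le_card_iff:
  fixes T :: "(nat \<times> 'a) set"
  assumes "finite T" "inj_on fst T"
  shows "Suc t \<le> card T \<longleftrightarrow> (\<exists>a\<in>T. t \<le> card {z\<in>T. fst a < fst z})"
proof
  assume *: "Suc t \<le> card T"
  then have "T \<noteq> {}" by auto
  then obtain b where "b \<in> T" by auto
  then have "\<exists>a. a \<in> T \<and> (\<forall>b. b \<in> T \<longrightarrow> fst a \<le> fst b)"
    by (rule ex_has_least_nat)
  then obtain a where a: "a \<in> T" "\<And>b. b \<in> T \<Longrightarrow> fst a \<le> fst b"
    by blast
  have "fst a < fst z" if "z \<in> T" "z \<noteq> a" for z
    using a that assms(2) by (metis inj_onD order_less_le)
  then have "T - {a} = {z\<in>T. fst a < fst z}" by auto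
  then have "card {z\<in>T. fst a < fst z} = card T - 1"
    using a(1) assms(1) by (metis card_Diff_singleton)
  then show "\<exists>a\<in>T. t \<le> card {z\<in>T. fst a < fst z}"
    using a(1) * by (intro bexI[of _ a]) auto
next
  assume "\<exists>a\<in>T. t \<le> card {z\<in>T. fst a < fst z}"
  then obtain a where a: "a \<in> T" "t \<le> card {z\<in>T. fst a < fst z}" by auto
  have "Suc (card {z\<in>T. fst a < fst z}) = card (insert a {z\<in>T. fst a < fst z})"
    using assms(1) by simp
  also have "\<dots> \<le> card T"
    using a(1) assms(1) by (intro card_mono) auto
  finally show "Suc t \<le> card T" using a(2) by simp
qed

text \<open>Here \<open>\<chi> z\<close> is a formula about the variables \<open>0\<close>, \<open>1\<close>, \<open>z\<close>. The witnesses are bound to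
  fresh variables in increasing position order, so that distinctness is automatic.\<close>

primrec at_least_after :: "(nat \<Rightarrow> toto) \<Rightarrow> nat \<Rightarrow> nat \<Rightarrow> toto" where
  "at_least_after \<chi> 0 u = Eq 0 0"
| "at_least_after \<chi> (Suc t) u =
    Ex (Suc u) (Conj (Conj (LessP u (Suc u)) (\<chi> (Suc u))) (at_least_after \<chi> t (Suc u)))"

primrec at_least :: "(nat \<Rightarrow> toto) \<Rightarrow> nat \<Rightarrow> toto" where
  "at_least \<chi> 0 = Eq 0 0"
| "at_least \<chi> (Suc t) = Ex 2 (Conj (\<chi> 2) (at_least_after \<chi> t 2))"

text \<open>The restriction \<open>z \<ge> 2\<close> keeps counted variables apart from the
  parameters \<open>0\<close> and \<open>1\<close>, whose values therefore survive every quantifier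
  of a counting formula.\<close>

definition expresses where
  "expresses \<sigma> \<chi> S \<longleftrightarrow> (\<forall>v z. z \<ge> 2 \<longrightarrow> sat \<sigma> v (\<chi> z) = S (v 0) (v 1) (v z))"

lemma sat_at_least_after:
  assumes \<chi>: "expresses \<sigma> \<chi> S"
    and "u \<ge> 2"
  shows "sat \<sigma> v (at_least_after \<chi> t u) \<longleftrightarrow>
    t \<le> card {z\<in>elems \<sigma>. S (v 0) (v 1) z \<and> fst (v u) < fst z}"
  using assms(2)
proof (induction t arbitrary: u v)
  case 0
  then show ?case by simp
next
  case (Suc t)
  let ?T = "{z\<in>elems \<sigma>. S (v 0) (v 1) z \<and> fst (v u) < fst z}"
  have "sat \<sigma> v (at_least_after \<chi> (Suc t) u) \<longleftrightarrow>
    (\<exists>a\<in>elems \<sigma>. fst (v u) < fst a \<and> S (v 0) (v 1) a \<and>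
       t \<le> card {z\<in>elems \<sigma>. S (v 0) (v 1) z \<and> fst a < fst z})"
    using Suc.prems \<chi> by (simp add: expresses_def Suc.IH)
  also have "\<dots> \<longleftrightarrow> (\<exists>a\<in>?T. t \<le> card {z\<in>?T. fst a < fst z})"
  proof -
    have "{z\<in>?T. fst a < fst z} = {z\<in>elems \<sigma>. S (v 0) (v 1) z \<and> fst a < fst z}"
      if "a \<in> ?T" for a
      using that by auto
    then have "(\<exists>a\<in>?T. t \<le> card {z\<in>?T. fst a < fst z}) \<longleftrightarrow>
        (\<exists>a\<in>?T. t \<le> card {z\<in>elems \<sigma>. S (v 0) (v 1) z \<and> fst a < fst z})"
      by (intro bex_cong) simp_all
    then show ?thesis by blast
  qed
  also have "\<dots> \<longleftrightarrow> Suc t \<le> card ?T"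
    by (intro Suc_le_card_iff[symmetric] inj_on_subset[OF inj_on_fst_elems])
      (auto simp: finite_elems)
  finally show ?case .
qed

lemma sat_at_least:
  assumes \<chi>: "expresses \<sigma> \<chi> S"
  shows "sat \<sigma> v (at_least \<chi> t) \<longleftrightarrow> t \<le> card {z\<in>elems \<sigma>. S (v 0) (v 1) z}"
proof (cases t)
  case 0
  then show ?thesis by simp
next
  case (Suc t')
  let ?T = "{z\<in>elems \<sigma>. S (v 0) (v 1) z}"
  have "sat \<sigma> v (at_least \<chi> (Suc t')) \<longleftrightarrow> (\<exists>a\<in>elems \<sigma>. S (v 0) (v 1) a \<and>
       t' \<le> card {z\<in>elems \<sigma>. S (v 0) (v 1) z \<and> fst a < fst z})"
    using \<chi> by (simp add: sat_at_least_after[OF \<chi>] expresses_def)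
  also have "\<dots> \<longleftrightarrow> (\<exists>a\<in>?T. t' \<le> card {z\<in>?T. fst a < fst z})"
    by (simp add: conj_assoc Bex_def)
  also have "\<dots> \<longleftrightarrow> Suc t' \<le> card ?T"
    by (intro Suc_le_card_iff[symmetric] inj_on_subset[OF inj_on_fst_elems])
      (auto simp: finite_elems)
  finally show ?thesis using Suc by simp
qed

lemma free_vars_at_least_after:
  assumes "\<forall>z. free_vars (\<chi> z) \<subseteq> {0, 1, z}"
  shows "free_vars (at_least_after \<chi> t u) \<subseteq> {0, 1, u}"
proof (induction t arbitrary: u)
  case (Suc t)
  have "free_vars (\<chi> (Suc u)) - {Suc u} \<subseteq> {0, 1}"
    using assms by blast
  moreover have "free_vars (at_least_after \<chi> t (Suc u)) - {Suc u} \<subseteq> {0, 1}"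
    using Suc.IH[of "Suc u"] by blast
  ultimately show ?case by auto
qed simp

lemma free_vars_at_least:
  assumes "\<forall>z. free_vars (\<chi> z) \<subseteq> {0, 1, z}"
  shows "free_vars (at_least \<chi> t) \<subseteq> {0, 1}"
proof (cases t)
  case (Suc t')
  have "free_vars (\<chi> 2) - {2} \<subseteq> {0, 1}"
    using assms by blast
  moreover have "free_vars (at_least_after \<chi> t' 2) - {2} \<subseteq> {0, 1}"
    using free_vars_at_least_after[OF assms, of t' 2] by blast
  ultimately show ?thesis using Suc by auto
qed simp

section \<open>Comparing counts up to a bound\<close>

definition Iff :: "toto \<Rightarrow> toto \<Rightarrow> toto" where
  "Iff \<phi> \<psi> = Conj (Neg (Conj \<phi> (Neg \<psi>))) (Neg (Conj \<psi> (Neg \<phi>)))"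

lemma sat_Iff [simp]: "sat \<sigma> v (Iff \<phi> \<psi>) \<longleftrightarrow> (sat \<sigma> v \<phi> \<longleftrightarrow> sat \<sigma> v \<psi>)"
  by (auto simp: Iff_def)

lemma free_vars_Iff [simp]: "free_vars (Iff \<phi> \<psi>) = free_vars \<phi> \<union> free_vars \<psi>"
  by (auto simp: Iff_def)

text \<open>Two counts agree after truncation at \<open>t\<close> iff they reach the same thresholds
  among \<open>1\<close>, ..., \<open>t\<close>; \<open>Eq 0 0\<close> stands for truth.\<close>

primrec same_count :: "(nat \<Rightarrow> toto) \<Rightarrow> (nat \<Rightarrow> toto) \<Rightarrow> nat \<Rightarrow> toto" where
  "same_count \<chi> \<psi> 0 = Eq 0 0"
| "same_count \<chi> \<psi> (Suc t) =
    Conj (Iff (at_least \<chi> (Suc t)) (at_least \<psi> (Suc t))) (same_count \<chi> \<psi> t)"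

lemma sat_same_count:
  assumes \<chi>: "expresses \<sigma> \<chi> S"
    and \<psi>: "expresses \<sigma> \<psi> T"
  shows "sat \<sigma> v (same_count \<chi> \<psi> t) \<longleftrightarrow>
    min t (card {z\<in>elems \<sigma>. S (v 0) (v 1) z}) = min t (card {z\<in>elems \<sigma>. T (v 0) (v 1) z})"
proof (induction t)
  case (Suc t)
  have "min (Suc t) a = min (Suc t) b \<longleftrightarrow> (Suc t \<le> a \<longleftrightarrow> Suc t \<le> b) \<and> min t a = min t b" for a b
    by linarith
  then show ?case
    using Suc sat_at_least[OF \<chi>, of v "Suc t"] sat_at_least[OF \<psi>, of v "Suc t"]
    by (simp del: at_least.simps)
qed simp

lemma free_vars_same_count:
  assumes "\<forall>z. free_vars (\<chi> z) \<subseteq> {0, 1, z}" "\<forall>z. free_vars (\<psi> z) \<subseteq> {0, 1, z}"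
  shows "free_vars (same_count \<chi> \<psi> t) \<subseteq> {0, 1}"
proof (induction t)
  case (Suc t)
  then show ?case
    using free_vars_at_least[OF assms(1), of "Suc t"] free_vars_at_least[OF assms(2), of "Suc t"]
    by (simp del: at_least.simps)
qed simp

text \<open>For \<open>t\<close> large enough, this says that the value of \<open>x\<close> is the
  position of \<open>y\<close>. Having \<open>x\<close> and \<open>y\<close> as parameters allows
  both equations of a transposition to be written.\<close>

definition value_eq_pos :: "nat \<Rightarrow> nat \<Rightarrow> nat \<Rightarrow> toto" where
  "value_eq_pos x y t = same_count (\<lambda>z. Conj (Neg (LessP y z)) (LessV x z))
     (\<lambda>z. Conj (LessP y z) (Neg (LessV x z))) t"

lemma free_vars_value_eq_pos:
  "x \<in> {0, 1} \<Longrightarrow> y \<in> {0, 1} \<Longrightarrow> free_vars (value_eq_pos x y t) \<subseteq> {0, 1}"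
  unfolding value_eq_pos_def by (rule free_vars_same_count) auto

lemma sat_value_eq_pos:
  assumes "x \<in> {0, 1}" "y \<in> {0, 1}"
  shows "sat \<sigma> v (value_eq_pos x y t) \<longleftrightarrow>
    min t (card {z\<in>elems \<sigma>. fst z \<le> fst (v y) \<and> snd (v x) < snd z}) =
    min t (card {z\<in>elems \<sigma>. fst (v y) < fst z \<and> snd z \<le> snd (v x)})"
proof -
  \<comment> \<open>\<open>expresses\<close> hands over only the values of the variables
    \<open>0\<close> and \<open>1\<close>; the case distinctions select the ones denoted by
    \<open>x\<close> and \<open>y\<close>.\<close>
  define S where "S = (\<lambda>p q z. fst z \<le> fst (if y = 0 then p else q :: nat \<times> nat) \<and>
    snd (if x = 0 then p else q :: nat \<times> nat) < snd (z :: nat \<times> nat))"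
  define T where "T = (\<lambda>p q z. fst (if y = 0 then p else q :: nat \<times> nat) < fst z \<and>
    snd (z :: nat \<times> nat) \<le> snd (if x = 0 then p else q :: nat \<times> nat))"
  have ST: "S (v 0) (v 1) = (\<lambda>z. fst z \<le> fst (v y) \<and> snd (v x) < snd z)"
    "T (v 0) (v 1) = (\<lambda>z. fst (v y) < fst z \<and> snd z \<le> snd (v x))"
    for v :: "nat \<Rightarrow> nat \<times> nat"
    using assms by (auto simp: S_def T_def)
  have "sat \<sigma> v (value_eq_pos x y t) \<longleftrightarrow>
    min t (card {z\<in>elems \<sigma>. S (v 0) (v 1) z}) = min t (card {z\<in>elems \<sigma>. T (v 0) (v 1) z})"
    unfolding value_eq_pos_def
    by (rule sat_same_count; unfold expresses_def ST) (use assms in auto)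
  then show ?thesis unfolding ST .
qed

section \<open>Patterns forced by large counts\<close>

lemma card_elems_pos_le:
  assumes "q \<le> fst \<sigma>"
  shows "card {z\<in>elems \<sigma>. fst z \<le> q} = q"
proof -
  have "fst ` {z\<in>elems \<sigma>. fst z \<le> q} = {1..q}"
    using assms by (force simp: elems_def image_iff)
  moreover have "inj_on fst {z\<in>elems \<sigma>. fst z \<le> q}"
    by (auto intro: inj_on_subset[OF inj_on_fst_elems])
  ultimately show ?thesis by (metis card_atLeastAtMost card_image diff_Suc_1)
qed

lemma card_elems_value_le:
  assumes "is_perm \<sigma>" "w \<le> fst \<sigma>"
  shows "card {z\<in>elems \<sigma>. snd z \<le> w} = w"
proof -
  have p: "snd \<sigma> permutes {1..fst \<sigma>}" using assms(1) by (simp add: is_perm_def)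
  have "i \<in> snd ` {z\<in>elems \<sigma>. snd z \<le> w}" if "i \<in> {1..w}" for i
  proof -
    have "i \<in> snd \<sigma> ` {1..fst \<sigma>}" using that assms(2) permutes_image[OF p] by auto
    then show ?thesis using that by (force simp: elems_def)
  qed
  moreover have "1 \<le> snd z" if "z \<in> elems \<sigma>" for z
    using that permutes_in_image[OF p] by (force simp: elems_def)
  ultimately have "snd ` {z\<in>elems \<sigma>. snd z \<le> w} = {1..w}" by fastforce
  moreover have "inj_on snd {z\<in>elems \<sigma>. snd z \<le> w}"
    using permutes_inj[OF p] by (auto simp: inj_on_def elems_def)
  ultimately show ?thesis by (metis card_atLeastAtMost card_image diff_Suc_1)
qed

text \<open>There are \<open>q\<close> points at positions up to \<open>q\<close> and
  \<open>w\<close> points with values up to \<open>w\<close>. Removing the common part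
  \<open>?D\<close> from both sets leaves the two counted regions.\<close>

lemma value_eq_pos_iff_card:
  assumes "is_perm \<sigma>" "q \<le> fst \<sigma>" "w \<le> fst \<sigma>"
  shows "w = q \<longleftrightarrow>
    card {z\<in>elems \<sigma>. fst z \<le> q \<and> w < snd z} = card {z\<in>elems \<sigma>. q < fst z \<and> snd z \<le> w}"
proof -
  let ?A = "{z\<in>elems \<sigma>. fst z \<le> q \<and> w < snd z}"
  let ?B = "{z\<in>elems \<sigma>. q < fst z \<and> snd z \<le> w}"
  let ?D = "{z\<in>elems \<sigma>. fst z \<le> q \<and> snd z \<le> w}"
  have "{z\<in>elems \<sigma>. fst z \<le> q} = ?A \<union> ?D" "{z\<in>elems \<sigma>. snd z \<le> w} = ?B \<union> ?D"
    by auto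
  moreover have "card (?A \<union> ?D) = card ?A + card ?D" "card (?B \<union> ?D) = card ?B + card ?D"
    by (rule card_Un_disjoint; auto simp: finite_elems)+
  ultimately have "q = card ?A + card ?D" "w = card ?B + card ?D"
    using card_elems_pos_le[of q \<sigma>] card_elems_value_le[of \<sigma> w] assms by auto
  then show ?thesis by auto
qed

section \<open>Monotone subsets and the patterns they induce\<close>

lemma ex_strict_mono_enumeration:
  fixes M :: "nat set"
  assumes "finite M"
  obtains f where "f ` {1..card M} = M" "strict_mono_on {1..card M} f"
proof -
  obtain h where h: "bij_betw h {..<card M} M" "strict_mono_on {..<card M} h"
    using ex_bij_betw_strict_mono_card[OF assms] by blast
  have "(\<lambda>i. i - 1) ` {1..card M} = {..<card M}"
    by (force simp: image_iff intro: bexI[of _ "Suc _"])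
  then have "(h \<circ> (\<lambda>i. i - 1)) ` {1..card M} = M"
    using h(1) by (metis bij_betw_imp_surj_on image_comp)
  moreover have "strict_mono_on {1..card M} (h \<circ> (\<lambda>i. i - 1))"
    using h(2) by (auto simp: monotone_on_def)
  ultimately show ?thesis using that by blast
qed

text \<open>Ramsey's theorem for the graph joining two positions when \<open>s\<close> increases
  between them: cliques are increasing, independent sets decreasing. The bound \<open>r\<close> is
  chosen before \<open>X\<close> and \<open>s\<close>, so it serves a whole class.\<close>

lemma monotone_subset:
  "\<exists>r. \<forall>X (s::nat \<Rightarrow> nat). finite X \<and> inj_on s X \<and> r \<le> card X \<longrightarrow>
    (\<exists>R\<subseteq>X. card R = m \<and> strict_mono_on R s \<or> card R = k \<and> strict_antimono_on R s)"
proof -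
  obtain r where r: "\<And>(V::nat set) E. finite V \<Longrightarrow> r \<le> card V \<Longrightarrow>
      \<exists>R\<subseteq>V. card R = m \<and> clique R E \<or> card R = k \<and> indep R E"
    using ramsey2[of m k] by metis
  have "\<exists>R\<subseteq>X. card R = m \<and> strict_mono_on R s \<or> card R = k \<and> strict_antimono_on R s"
    if X: "finite X" "inj_on s X" "r \<le> card X" for X and s :: "nat \<Rightarrow> nat"
  proof -
    define E where "E = {{i, j} | i j. i < j \<and> s i < s j}"
    have E: "{i, j} \<in> E \<longleftrightarrow> s i < s j" if "i < j" for i j
      using that by (auto simp: E_def doubleton_eq_iff)
    obtain R where R: "R \<subseteq> X" "card R = m \<and> clique R E \<or> card R = k \<and> indep R E"
      using r[OF X(1,3), of E] by blast
    have "clique R E \<Longrightarrow> strict_mono_on R s"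
      by (auto simp: clique_def monotone_on_def E[symmetric])
    \<comment> \<open>Injectivity of \<open>s\<close> on \<open>X\<close> turns the absence of an
      increase into a strict decrease.\<close>
    moreover have "indep R E \<Longrightarrow> strict_antimono_on R s"
      using X(2) R(1) unfolding indep_def monotone_on_def inj_on_def
      by (metis E linorder_neqE_nat less_irrefl subsetD)
    ultimately show ?thesis using R by blast
  qed
  then show ?thesis by blast
qed

lemma delta_pattern:
  assumes "R \<subseteq> {1..fst \<sigma>}" "strict_antimono_on R (snd \<sigma>)"
  shows "is_pattern_of (delta (card R)) \<sigma>"
proof -
  obtain f where f: "f ` {1..card R} = R" "strict_mono_on {1..card R} f"
    using ex_strict_mono_enumeration assms(1) by (metis finite_atLeastAtMost finite_subset)
  have lt: "snd \<sigma> (f j) < snd \<sigma> (f i)" if "i \<in> {1..card R}" "j \<in> {1..card R}" "i < j" for i j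
  proof -
    have "f i < f j" using f(2) that by (auto simp: monotone_on_def)
    moreover have "f i \<in> R" "f j \<in> R" using f(1) that by blast+
    ultimately show ?thesis using assms(2) by (auto simp: monotone_on_def)
  qed
  have "card R + 1 - i < card R + 1 - j \<longleftrightarrow> snd \<sigma> (f i) < snd \<sigma> (f j)"
    if "i \<in> {1..card R}" "j \<in> {1..card R}" for i j
    using lt[of i j] lt[of j i] that by (cases i j rule: linorder_cases) auto
  then show ?thesis
    using f assms(1) unfolding is_pattern_of_def delta_def by (intro exI[of _ f]) auto
qed

lemma iota_skew_sum_iota_pattern:
  assumes "R \<subseteq> {1..fst \<sigma>}" "R' \<subseteq> {1..fst \<sigma>}"
    and "strict_mono_on R (snd \<sigma>)" "strict_mono_on R' (snd \<sigma>)"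
    and RR': "\<And>i j. i \<in> R \<Longrightarrow> j \<in> R' \<Longrightarrow> i < j \<and> snd \<sigma> j < snd \<sigma> i"
  shows "is_pattern_of (iota (card R) \<ominus> iota (card R')) \<sigma>"
proof -
  let ?m = "card R" and ?n = "card R'"
  obtain f where f: "f ` {1..?m} = R" "strict_mono_on {1..?m} f"
    using ex_strict_mono_enumeration assms(1) by (metis finite_atLeastAtMost finite_subset)
  obtain g where g: "g ` {1..?n} = R'" "strict_mono_on {1..?n} g"
    using ex_strict_mono_enumeration assms(2) by (metis finite_atLeastAtMost finite_subset)
  \<comment> \<open>The embedding lists \<open>R\<close> first and then \<open>R'\<close>, the
    latter with indices shifted by \<open>?m\<close>.\<close>
  define h where "h i = (if i \<le> ?m then f i else g (i - ?m))" for i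
  let ?s = "snd (iota ?m \<ominus> iota ?n)"
  have fR: "f i \<in> R" if "i \<in> {1..?m}" for i using f(1) that by blast
  have gR: "g i \<in> R'" if "i \<in> {1..?n}" for i using g(1) that by blast
  \<comment> \<open>Both directions of the value comparison are recorded, so that the case
    \<open>j < i\<close> follows by exchanging the indices.\<close>
  have lt: "h i < h j \<and> (?s i < ?s j \<longleftrightarrow> snd \<sigma> (h i) < snd \<sigma> (h j)) \<and>
      (?s j < ?s i \<longleftrightarrow> snd \<sigma> (h j) < snd \<sigma> (h i))"
    if ij: "i \<in> {1..?m + ?n}" "j \<in> {1..?m + ?n}" "i < j" for i j
  proof -
    consider "j \<le> ?m" | "i \<le> ?m" "?m < j" | "?m < i" using ij by linarith
    then show ?thesis
    proof cases
      case 1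
      then have "f i < f j" using f(2) ij by (auto simp: monotone_on_def)
      moreover from this have "snd \<sigma> (f i) < snd \<sigma> (f j)"
        using assms(3) fR ij 1 by (auto simp: monotone_on_def)
      ultimately show ?thesis using ij 1 by (auto simp: h_def skew_sum_def iota_def)
    next
      case 2
      then have "f i < g (j - ?m) \<and> snd \<sigma> (g (j - ?m)) < snd \<sigma> (f i)"
        using ij by (intro RR' fR gR) auto
      then show ?thesis using ij 2 by (auto simp: h_def skew_sum_def iota_def)
    next
      case 3
      then have "i - ?m \<in> {1..?n}" "j - ?m \<in> {1..?n}" "i - ?m < j - ?m" using ij by auto
      then have "g (i - ?m) \<in> R'" "g (j - ?m) \<in> R'" "g (i - ?m) < g (j - ?m)"
        using gR g(2) by (auto simp: monotone_on_def)
      moreover from this have "snd \<sigma> (g (i - ?m)) < snd \<sigma> (g (j - ?m))"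
        using assms(4) by (auto simp: monotone_on_def)
      ultimately show ?thesis using ij 3 by (auto simp: h_def skew_sum_def iota_def)
    qed
  qed
  have "?s i < ?s j \<longleftrightarrow> snd \<sigma> (h i) < snd \<sigma> (h j)"
    if "i \<in> {1..?m + ?n}" "j \<in> {1..?m + ?n}" for i j
    using lt[of i j] lt[of j i] that by (cases i j rule: linorder_cases) auto
  moreover have "strict_mono_on {1..?m + ?n} h"
    using lt by (auto simp: monotone_on_def)
  moreover have "h ` {1..?m + ?n} \<subseteq> {1..fst \<sigma>}"
  proof (rule image_subsetI)
    fix i assume "i \<in> {1..?m + ?n}"
    then have "i \<in> {1..?m} \<or> \<not> i \<le> ?m \<and> i - ?m \<in> {1..?n}" by auto
    then have "h i \<in> R \<union> R'" using fR[of i] gR[of "i - ?m"] by (auto simp: h_def)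
    then show "h i \<in> {1..fst \<sigma>}" using assms(1,2) by blast
  qed
  moreover have "fst (iota ?m \<ominus> iota ?n) = ?m + ?n" by (simp add: skew_sum_def iota_def)
  ultimately show ?thesis unfolding is_pattern_of_def by (intro exI[of _ h]) simp
qed

text \<open>The two counted regions lie to the upper left and to the lower right of a common point,
  so if both were large, Ramsey's theorem would yield one of the two excluded patterns.\<close>

lemma bounded_counts:
  assumes "perm_class C" "delta k \<notin> C" "iota m \<ominus> iota n \<notin> C"
  obtains r where "\<And>\<sigma> q w. \<sigma> \<in> C \<Longrightarrow>
    card {z\<in>elems \<sigma>. fst z \<le> q \<and> w < snd z} < r \<or>
    card {z\<in>elems \<sigma>. q < fst z \<and> snd z \<le> w} < r"
proof -
  obtain r where r: "\<And>X s. finite X \<Longrightarrow> inj_on s X \<Longrightarrow> r \<le> card X \<Longrightarrow>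
    \<exists>R\<subseteq>X. card R = m \<and> strict_mono_on R (s::nat\<Rightarrow>nat) \<or> card R = k \<and> strict_antimono_on R s"
    using monotone_subset[of m k] by metis
  obtain r' where r': "\<And>X s. finite X \<Longrightarrow> inj_on s X \<Longrightarrow> r' \<le> card X \<Longrightarrow>
    \<exists>R\<subseteq>X. card R = n \<and> strict_mono_on R (s::nat\<Rightarrow>nat) \<or> card R = k \<and> strict_antimono_on R s"
    using monotone_subset[of n k] by metis
  have "card {z\<in>elems \<sigma>. fst z \<le> q \<and> w < snd z} < max r r' \<or>
    card {z\<in>elems \<sigma>. q < fst z \<and> snd z \<le> w} < max r r'" if \<sigma>: "\<sigma> \<in> C" for \<sigma> q w
  proof (rule ccontr)
    assume "\<not> ?thesis"
    then have big: "r \<le> card {z\<in>elems \<sigma>. fst z \<le> q \<and> w < snd z}"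
      "r' \<le> card {z\<in>elems \<sigma>. q < fst z \<and> snd z \<le> w}"
      by auto
    \<comment> \<open>The regions are replaced by their sets of positions, since the Ramsey bound
      speaks of maps on numbers.\<close>
    let ?X = "{i\<in>{1..fst \<sigma>}. i \<le> q \<and> w < snd \<sigma> i}"
    let ?Y = "{i\<in>{1..fst \<sigma>}. q < i \<and> snd \<sigma> i \<le> w}"
    have "snd \<sigma> permutes {1..fst \<sigma>}" using assms(1) \<sigma> by (auto simp: perm_class_def is_perm_def)
    then have inj: "inj_on (snd \<sigma>) Z" for Z
      using permutes_inj inj_on_subset by blast
    have "card {z\<in>elems \<sigma>. fst z \<le> q \<and> w < snd z} = card ?X"
      by (rule card_bij_eq[of fst _ _ "\<lambda>i. (i, snd \<sigma> i)"])
        (auto simp: finite_elems elems_def inj_on_def)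
    moreover have "card {z\<in>elems \<sigma>. q < fst z \<and> snd z \<le> w} = card ?Y"
      by (rule card_bij_eq[of fst _ _ "\<lambda>i. (i, snd \<sigma> i)"])
        (auto simp: finite_elems elems_def inj_on_def)
    ultimately have cards: "r \<le> card ?X" "r' \<le> card ?Y" using big by simp_all
    have pat: "\<pi> \<in> C" if "is_perm \<pi>" "is_pattern_of \<pi> \<sigma>" for \<pi>
      using assms(1) \<sigma> that unfolding perm_class_def by blast
    have no_delta: "\<not> (card R = k \<and> strict_antimono_on R (snd \<sigma>))" if "R \<subseteq> {1..fst \<sigma>}" for R
      using delta_pattern[OF that] pat is_perm_delta assms(2) by blast
    have "finite ?X" by simp
    then obtain R where "R \<subseteq> ?X"
      "card R = m \<and> strict_mono_on R (snd \<sigma>) \<or> card R = k \<and> strict_antimono_on R (snd \<sigma>)"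
      using r[OF _ inj cards(1)] by blast
    moreover from this have "R \<subseteq> {1..fst \<sigma>}" by blast
    ultimately have R: "R \<subseteq> ?X" "card R = m" "strict_mono_on R (snd \<sigma>)"
      using no_delta[of R] by blast+
    have "finite ?Y" by simp
    then obtain R' where "R' \<subseteq> ?Y"
      "card R' = n \<and> strict_mono_on R' (snd \<sigma>) \<or> card R' = k \<and> strict_antimono_on R' (snd \<sigma>)"
      using r'[OF _ inj cards(2)] by blast
    moreover from this have "R' \<subseteq> {1..fst \<sigma>}" by blast
    ultimately have R': "R' \<subseteq> ?Y" "card R' = n" "strict_mono_on R' (snd \<sigma>)"
      using no_delta[of R'] by blast+
    \<comment> \<open>The point with position \<open>q\<close> and value \<open>w\<close> separates
      the regions: \<open>i \<le> q < j\<close>, while the value at \<open>j\<close> is at most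
      \<open>w\<close> and the value at \<open>i\<close> exceeds \<open>w\<close>.\<close>
    have "i < j \<and> snd \<sigma> j < snd \<sigma> i" if "i \<in> R" "j \<in> R'" for i j
      using that R(1) R'(1) by fastforce
    then have "is_pattern_of (iota (card R) \<ominus> iota (card R')) \<sigma>"
      using R R' by (intro iota_skew_sum_iota_pattern) auto
    then show False using pat is_perm_iota_skew_sum_iota assms(3) R(2) R'(2) by blast
  qed
  then show ?thesis using that by blast
qed

text \<open>The formula says that the points differ and that each one's value is the other's
  position. One of the two counts is always below \<open>r\<close>, so equality after truncation at
  \<open>r\<close> is true equality.\<close>

lemma transposition_formula:
  assumes "perm_class C" "delta k \<notin> C" "iota m \<ominus> iota n \<notin> C"
  shows "\<exists>\<phi>. binary_formula \<phi> \<and> (\<forall>\<sigma>\<in>C. \<forall>a\<in>elems \<sigma>. \<forall>b\<in>elems \<sigma>.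
    sat2 \<sigma> a b \<phi> \<longleftrightarrow> is_transposition \<sigma> a b)"
proof -
  obtain r where r: "\<And>\<sigma> q w. \<sigma> \<in> C \<Longrightarrow>
      card {z\<in>elems \<sigma>. fst z \<le> q \<and> w < snd z} < r \<or>
      card {z\<in>elems \<sigma>. q < fst z \<and> snd z \<le> w} < r"
    using bounded_counts[OF assms] by blast
  define \<phi> where "\<phi> = Conj (Neg (Eq 0 1)) (Conj (value_eq_pos 0 1 r) (value_eq_pos 1 0 r))"
  have "sat2 \<sigma> a b \<phi> \<longleftrightarrow> is_transposition \<sigma> a b"
    if \<sigma>: "\<sigma> \<in> C" and ab: "a \<in> elems \<sigma>" "b \<in> elems \<sigma>" for \<sigma> a b
  proof -
    have perm: "is_perm \<sigma>" using \<sigma> assms(1) by (auto simp: perm_class_def)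
    then have "snd \<sigma> permutes {1..fst \<sigma>}" by (simp add: is_perm_def)
    then have le: "fst c \<le> fst \<sigma>" "snd c \<le> fst \<sigma>" if "c \<in> elems \<sigma>" for c
      using that permutes_in_image by (force simp: elems_def)+
    have "min r (card {z\<in>elems \<sigma>. fst z \<le> fst d \<and> snd c < snd z}) =
        min r (card {z\<in>elems \<sigma>. fst d < fst z \<and> snd z \<le> snd c}) \<longleftrightarrow> snd c = fst d"
      if "c \<in> elems \<sigma>" "d \<in> elems \<sigma>" for c d
      using value_eq_pos_iff_card[OF perm le(1)[OF that(2)] le(2)[OF that(1)]]
        r[OF \<sigma>, of "fst d" "snd c"] by (auto simp: min_def split: if_splits)
    then have "sat2 \<sigma> a b \<phi> \<longleftrightarrow> a \<noteq> b \<and> snd a = fst b \<and> snd b = fst a"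
      using ab by (simp add: sat2_def \<phi>_def sat_value_eq_pos)
    also have "\<dots> \<longleftrightarrow> is_transposition \<sigma> a b"
      using ab by (auto simp: is_transposition_def elems_def)
    finally show ?thesis .
  qed
  moreover have "binary_formula \<phi>"
    using free_vars_value_eq_pos[of 0 1 r] free_vars_value_eq_pos[of 1 0 r]
    by (auto simp: binary_formula_def \<phi>_def)
  ultimately show ?thesis by blast
qed

section \<open>Ehrenfeucht--Fraisse games on linear orders\<close>

text \<open>The usual threshold equivalence of distances for \<open>r\<close> remaining rounds, with
  signs so that the order is recorded too.\<close>

definition near :: "nat \<Rightarrow> int \<Rightarrow> int \<Rightarrow> bool" where
  "near r a b \<longleftrightarrow> a = b \<or> 2 ^ r \<le> a \<and> 2 ^ r \<le> b \<or> a \<le> - (2 ^ r) \<and> b \<le> - (2 ^ r)"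

text \<open>Duplicator's invariant: \<open>Z\<close> pairs chosen points with their copies, and
  corresponding distances are indistinguishable in \<open>r\<close> rounds.\<close>

definition near_set :: "nat \<Rightarrow> (int \<times> int) set \<Rightarrow> bool" where
  "near_set r Z \<longleftrightarrow> (\<forall>(p, q)\<in>Z. \<forall>(p', q')\<in>Z. near r (p - p') (q - q'))"

lemma near_setD: "near_set r Z \<Longrightarrow> (p, q) \<in> Z \<Longrightarrow> (p', q') \<in> Z \<Longrightarrow> near r (p - p') (q - q')"
  by (auto simp: near_set_def)

text \<open>Since \<open>2 ^ r\<close> is positive, being far apart fixes the sign. Hence a near set
  is a partial isomorphism of orders.\<close>

lemma near_signs: "near r a b \<Longrightarrow> (a < 0 \<longleftrightarrow> b < 0) \<and> (a = 0 \<longleftrightarrow> b = 0)"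
  using zero_less_power[of "2::int" r, OF zero_less_numeral] unfolding near_def by linarith

lemma near_set_less: "near_set r Z \<Longrightarrow> (p, q) \<in> Z \<Longrightarrow> (p', q') \<in> Z \<Longrightarrow> p < p' \<longleftrightarrow> q < q'"
  using near_signs[OF near_setD, of r Z p q p' q'] by auto

lemma near_set_eq: "near_set r Z \<Longrightarrow> (p, q) \<in> Z \<Longrightarrow> (p', q') \<in> Z \<Longrightarrow> p = p' \<longleftrightarrow> q = q'"
  using near_signs[OF near_setD, of r Z p q p' q'] by auto

lemma near_set_subset: "near_set r Z \<Longrightarrow> Z' \<subseteq> Z \<Longrightarrow> near_set r Z'"
  unfolding near_set_def by blast

lemma near_set_converse: "near_set r Z \<Longrightarrow> near_set r (Z\<inverse>)"
  by (fastforce simp: near_set_def near_def)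

lemma near_refl [simp]: "near r a a"
  by (simp add: near_def)

lemma near_uminus: "near r (- a) (- b) \<longleftrightarrow> near r a b"
  by (auto simp: near_def)

text \<open>Minimising the distance to \<open>c\<close>, a natural number, finds the neighbour
  without assuming \<open>Z\<close> finite.\<close>

lemma ex_greatest_below:
  fixes Z :: "(int \<times> 'a) set"
  assumes "(l, l') \<in> Z" "l \<le> c"
  shows "\<exists>a a'. (a, a') \<in> Z \<and> a \<le> c \<and> (\<forall>p p'. (p, p') \<in> Z \<and> p \<le> c \<longrightarrow> p \<le> a)"
proof -
  have "(l, l') \<in> Z \<and> fst (l, l') \<le> c" using assms by simp
  then have "\<exists>z. (z \<in> Z \<and> fst z \<le> c) \<and>
      (\<forall>y. y \<in> Z \<and> fst y \<le> c \<longrightarrow> nat (c - fst z) \<le> nat (c - fst y))"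
    by (rule ex_has_least_nat)
  then obtain z where z: "z \<in> Z" "fst z \<le> c"
    "\<And>y. y \<in> Z \<Longrightarrow> fst y \<le> c \<Longrightarrow> nat (c - fst z) \<le> nat (c - fst y)"
    by blast
  have "p \<le> fst z" if "(p, p') \<in> Z" "p \<le> c" for p p'
    using z(3)[OF that(1)] that(2) z(2) by simp
  moreover have "(fst z, snd z) \<in> Z" using z(1) by simp
  ultimately show ?thesis using z(2) by blast
qed

lemma ex_least_above:
  fixes Z :: "(int \<times> 'a) set"
  assumes "(u, u') \<in> Z" "c \<le> u"
  shows "\<exists>b b'. (b, b') \<in> Z \<and> c \<le> b \<and> (\<forall>p p'. (p, p') \<in> Z \<and> c \<le> p \<longrightarrow> b \<le> p)"
proof -
  have "(u, u') \<in> Z \<and> c \<le> fst (u, u')" using assms by simp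
  then have "\<exists>z. (z \<in> Z \<and> c \<le> fst z) \<and>
      (\<forall>y. y \<in> Z \<and> c \<le> fst y \<longrightarrow> nat (fst z - c) \<le> nat (fst y - c))"
    by (rule ex_has_least_nat)
  then obtain z where z: "z \<in> Z" "c \<le> fst z"
    "\<And>y. y \<in> Z \<Longrightarrow> c \<le> fst y \<Longrightarrow> nat (fst z - c) \<le> nat (fst y - c)"
    by blast
  have "fst z \<le> p" if "(p, p') \<in> Z" "c \<le> p" for p p'
    using z(3)[OF that(1)] that(2) z(2) by simp
  moreover have "(fst z, snd z) \<in> Z" using z(1) by simp
  ultimately show ?thesis using z(2) by blast
qed

text \<open>Halving the radius: the new point \<open>c\<close> is copied relative to the nearest old point if that
  is closer than \<open>2 ^ r\<close>, and is otherwise placed anywhere far from both neighbours.\<close>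

lemma near_set_extend:
  assumes Z: "near_set (Suc r) Z"
    and lo: "(l, l') \<in> Z" "l \<le> c" and hi: "(u, u') \<in> Z" "c \<le> u"
  obtains d where "near_set r (insert (c, d) Z)"
proof -
  obtain a a' where a: "(a, a') \<in> Z" "a \<le> c" "\<And>p p'. (p, p') \<in> Z \<Longrightarrow> p \<le> c \<Longrightarrow> p \<le> a"
    using ex_greatest_below[OF lo] by blast
  obtain b b' where b: "(b, b') \<in> Z" "c \<le> b" "\<And>p p'. (p, p') \<in> Z \<Longrightarrow> c \<le> p \<Longrightarrow> b \<le> p"
    using ex_least_above[OF hi] by blast
  \<comment> \<open>In the last case both gaps are at least \<open>2 ^ r\<close>, so
    \<open>b - a\<close>, and with it \<open>b' - a'\<close>, is at least \<open>2 ^ Suc r\<close>;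
    thus \<open>a' + 2 ^ r\<close> is also far from \<open>b'\<close>.\<close>
  define d where "d = (if c - a < 2 ^ r then a' + (c - a)
    else if b - c < 2 ^ r then b' - (b - c) else a' + 2 ^ r)"
  have new: "near r (p - c) (p' - d)" if p: "(p, p') \<in> Z" for p p'
  proof -
    have pa: "near (Suc r) (p - a) (p' - a')" and pb: "near (Suc r) (p - b) (p' - b')"
      and ab: "near (Suc r) (b - a) (b' - a')"
      using near_setD[OF Z] p a(1) b(1) by blast+
    have pow: "(2::int) ^ Suc r = 2 ^ r + 2 ^ r" "(0::int) < 2 ^ r" by auto
    \<comment> \<open>No old point lies strictly between the neighbours, so the distance from
      \<open>p\<close> to \<open>c\<close> is the sum of its distance to one neighbour and that
      neighbour's distance to \<open>c\<close>.\<close>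
    have "p \<le> a \<or> b \<le> p" using a(3)[OF p] b(3)[OF p] by linarith
    then show ?thesis
      using pa pb ab a(2) b(2) pow(2) unfolding near_def d_def pow(1)
      by (smt (verit))
  qed
  have "near r x y" if "near (Suc r) x y" for x y
    using that zero_less_power[of "2::int" r, OF zero_less_numeral]
    unfolding near_def power_Suc by linarith
  then have "near_set r Z" using Z unfolding near_set_def by blast
  moreover have "near r (c - p) (d - p')" if "(p, p') \<in> Z" for p p'
    using new[OF that] near_uminus[of r "p - c" "p' - d"] by simp
  ultimately have "near_set r (insert (c, d) Z)"
    using new by (auto simp: near_set_def)
  then show ?thesis using that by blast
qed

text \<open>An extra point \<open>mid\<close> is inserted into the position order; it marks the border between the
  two blocks of \<open>\<iota>\<^sub>m \<ominus> \<iota>\<^sub>n\<close> and is placed in front of everything for \<open>\<delta>\<^sub>k\<close>.\<close>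

definition coord :: "nat \<Rightarrow> nat \<times> nat \<Rightarrow> int" where
  "coord mid a = (if fst a < mid then int (fst a) else int (fst a) + 1)"

lemma coord_range:
  assumes "a \<in> elems \<sigma>"
  shows "0 < coord mid a" "coord mid a < int (fst \<sigma>) + 2" "coord mid a \<noteq> int mid"
  using assms by (auto simp: coord_def elems_def)

lemma coord_less_iff: "coord mid a < coord mid b \<longleftrightarrow> fst a < fst b"
  by (auto simp: coord_def)

lemma coord_less_mid_iff: "coord mid a < int mid \<longleftrightarrow> fst a < mid"
  by (auto simp: coord_def)

lemma coord_eq_iff: "a \<in> elems \<sigma> \<Longrightarrow> b \<in> elems \<sigma> \<Longrightarrow> coord mid a = coord mid b \<longleftrightarrow> a = b"
  by (auto simp: coord_def elems_def split: if_splits)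

lemma coord_surj:
  assumes "0 < d" "d < int (fst \<sigma>) + 2" "d \<noteq> int mid" "mid \<in> {1..fst \<sigma> + 1}"
  shows "\<exists>b\<in>elems \<sigma>. coord mid b = d"
proof (cases "d < int mid")
  case True
  then show ?thesis using assms
    by (intro bexI[of _ "(nat d, snd \<sigma> (nat d))"]) (auto simp: coord_def elems_def)
next
  case False
  then show ?thesis using assms
    by (intro bexI[of _ "(nat (d - 1), snd \<sigma> (nat (d - 1)))"]) (auto simp: coord_def elems_def)
qed

text \<open>Elements have coordinates from \<open>1\<close> to the size plus one, so the outer two
  pairs are sentinels enclosing all elements; the middle pair matches the block borders.\<close>

definition anchors :: "perm \<Rightarrow> nat \<Rightarrow> perm \<Rightarrow> nat \<Rightarrow> (int \<times> int) set" where
  "anchors \<sigma> mid \<tau> mid' = {(0, 0), (int mid, int mid'), (int (fst \<sigma>) + 2, int (fst \<tau>) + 2)}"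

definition position where
  "position \<sigma> mid \<tau> mid' v w =
    anchors \<sigma> mid \<tau> mid' \<union> range (\<lambda>x. (coord mid (v x), coord mid' (w x)))"

lemma position_converse: "(position \<sigma> mid \<tau> mid' v w)\<inverse> = position \<tau> mid' \<sigma> mid w v"
  by (auto simp: position_def anchors_def)

text \<open>Duplicator's answer to a move in \<open>\<sigma>\<close>. The anchors force the copied
  coordinate strictly between the sentinels and away from \<open>mid'\<close>, so it belongs to an
  element of \<open>\<tau>\<close>.\<close>

lemma position_forth:
  assumes Z: "near_set (Suc r) (position \<sigma> mid \<tau> mid' v w)"
    and mid': "mid' \<in> {1..fst \<tau> + 1}" and a: "a \<in> elems \<sigma>"
  shows "\<exists>b\<in>elems \<tau>. near_set r (position \<sigma> mid \<tau> mid' (v(x := a)) (w(x := b)))"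
proof -
  let ?Z = "position \<sigma> mid \<tau> mid' v w"
  have anc: "(0, 0) \<in> ?Z" "(int mid, int mid') \<in> ?Z" "(int (fst \<sigma>) + 2, int (fst \<tau>) + 2) \<in> ?Z"
    by (auto simp: position_def anchors_def)
  note c = coord_range[OF a, of mid]
  obtain d where d: "near_set r (insert (coord mid a, d) ?Z)"
    using near_set_extend[OF Z anc(1) _ anc(3), of "coord mid a"] c by auto
  have "0 < d" using near_set_less[OF d, of 0 0 "coord mid a" d] anc c by auto
  moreover have "d < int (fst \<tau>) + 2"
    using near_set_less[OF d, of "coord mid a" d "int (fst \<sigma>) + 2" "int (fst \<tau>) + 2"] anc c by auto
  moreover have "d \<noteq> int mid'"
    using near_set_eq[OF d, of "coord mid a" d "int mid" "int mid'"] anc c by auto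
  ultimately obtain b where b: "b \<in> elems \<tau>" "coord mid' b = d"
    using coord_surj mid' by blast
  have "position \<sigma> mid \<tau> mid' (v(x := a)) (w(x := b)) \<subseteq> insert (coord mid a, d) ?Z"
    using b(2) by (auto simp: position_def)
  then show ?thesis using b(1) near_set_subset[OF d] by blast
qed

section \<open>Transfer of formulas along game positions\<close>

primrec quantifier_rank :: "toto \<Rightarrow> nat" where
  "quantifier_rank (Eq x y) = 0"
| "quantifier_rank (LessP x y) = 0"
| "quantifier_rank (LessV x y) = 0"
| "quantifier_rank (Neg \<phi>) = quantifier_rank \<phi>"
| "quantifier_rank (Conj \<phi> \<psi>) = max (quantifier_rank \<phi>) (quantifier_rank \<psi>)"
| "quantifier_rank (Ex x \<phi>) = Suc (quantifier_rank \<phi>)"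

text \<open>Value comparisons follow from position order and side of the border by the same rule in
  both permutations, so a game on positions alone also settles \<open>LessV\<close>.\<close>

definition same_values :: "perm \<Rightarrow> nat \<Rightarrow> perm \<Rightarrow> nat \<Rightarrow> bool" where
  "same_values \<sigma> mid \<tau> mid' \<longleftrightarrow>
    (\<forall>a\<in>elems \<sigma>. \<forall>b\<in>elems \<sigma>. \<forall>a'\<in>elems \<tau>. \<forall>b'\<in>elems \<tau>.
      (fst a < fst b \<longleftrightarrow> fst a' < fst b') \<longrightarrow> (fst b < fst a \<longleftrightarrow> fst b' < fst a') \<longrightarrow>
      (fst a < mid \<longleftrightarrow> fst a' < mid') \<longrightarrow> (fst b < mid \<longleftrightarrow> fst b' < mid') \<longrightarrow>
      (snd a < snd b \<longleftrightarrow> snd a' < snd b'))"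

lemma near_set_mono:
  assumes "near_set r Z" "s \<le> r"
  shows "near_set s Z"
proof -
  have "(2::int) ^ s \<le> 2 ^ r" using assms(2) by (simp add: power_increasing)
  then have "near r x y \<Longrightarrow> near s x y" for x y unfolding near_def by linarith
  then show ?thesis using assms(1) unfolding near_set_def by blast
qed

text \<open>Atomic formulas depend only on the order of the coordinates, which a near set preserves;
  each quantifier uses up one round of the invariant.\<close>

lemma sat_cong_position:
  assumes "mid \<in> {1..fst \<sigma> + 1}" "mid' \<in> {1..fst \<tau> + 1}" "same_values \<sigma> mid \<tau> mid'"
    and "near_set (quantifier_rank \<phi>) (position \<sigma> mid \<tau> mid' v w)"
    and "range v \<subseteq> elems \<sigma>" "range w \<subseteq> elems \<tau>"
  shows "sat \<sigma> v \<phi> \<longleftrightarrow> sat \<tau> w \<phi>"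
  using assms(4-6)
proof (induction \<phi> arbitrary: v w)
  case (Eq x y)
  have "coord mid (v x) = coord mid (v y) \<longleftrightarrow> coord mid' (w x) = coord mid' (w y)"
    by (rule near_set_eq[OF Eq(1)]) (auto simp: position_def)
  moreover have "v x \<in> elems \<sigma>" "v y \<in> elems \<sigma>" "w x \<in> elems \<tau>" "w y \<in> elems \<tau>"
    using Eq(2,3) by auto
  ultimately show ?case by (simp add: coord_eq_iff)
next
  case (LessP x y)
  have "coord mid (v x) < coord mid (v y) \<longleftrightarrow> coord mid' (w x) < coord mid' (w y)"
    by (rule near_set_less[OF LessP(1)]) (auto simp: position_def)
  then show ?case by (simp add: coord_less_iff)
next
  case (LessV x y)
  have less: "fst (v x) < fst (v y) \<longleftrightarrow> fst (w x) < fst (w y)" for x y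
    using near_set_less[OF LessV(1), of "coord mid (v x)" "coord mid' (w x)"
        "coord mid (v y)" "coord mid' (w y)"]
    by (auto simp: position_def coord_less_iff)
  have "coord mid (v x) < int mid \<longleftrightarrow> coord mid' (w x) < int mid'" for x
    by (rule near_set_less[OF LessV(1)]) (auto simp: position_def anchors_def)
  then have below: "fst (v x) < mid \<longleftrightarrow> fst (w x) < mid'" for x
    by (simp add: coord_less_mid_iff)
  have "v x \<in> elems \<sigma>" "v y \<in> elems \<sigma>" "w x \<in> elems \<tau>" "w y \<in> elems \<tau>"
    using LessV(2,3) by auto
  then have "snd (v x) < snd (v y) \<longleftrightarrow> snd (w x) < snd (w y)"
    using assms(3) less[of x y] less[of y x] below[of x] below[of y]
    unfolding same_values_def by blast
  then show ?case by simp
next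
  case (Neg \<phi>)
  then show ?case by simp
next
  case (Conj \<phi> \<psi>)
  have "near_set (quantifier_rank \<phi>) (position \<sigma> mid \<tau> mid' v w)"
    "near_set (quantifier_rank \<psi>) (position \<sigma> mid \<tau> mid' v w)"
    using Conj.prems(1) by (auto elim: near_set_mono)
  then show ?case using Conj by simp
next
  case (Ex x \<phi>)
  have Z: "near_set (Suc (quantifier_rank \<phi>)) (position \<sigma> mid \<tau> mid' v w)"
    using Ex.prems(1) by simp
  \<comment> \<open>Reversing the pairs lets \<open>position_forth\<close> also answer moves made in
    \<open>\<tau>\<close>.\<close>
  then have Z': "near_set (Suc (quantifier_rank \<phi>)) (position \<tau> mid' \<sigma> mid w v)"
    by (metis near_set_converse position_converse)
  have IH: "sat \<sigma> (v(x := a)) \<phi> \<longleftrightarrow> sat \<tau> (w(x := b)) \<phi>"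
    if "a \<in> elems \<sigma>" "b \<in> elems \<tau>"
      "near_set (quantifier_rank \<phi>) (position \<sigma> mid \<tau> mid' (v(x := a)) (w(x := b)))" for a b
    by (rule Ex.IH[OF that(3)]) (use that(1,2) Ex.prems(2,3) in auto)
  have "\<exists>b\<in>elems \<tau>. sat \<sigma> (v(x := a)) \<phi> \<longleftrightarrow> sat \<tau> (w(x := b)) \<phi>" if "a \<in> elems \<sigma>" for a
    using position_forth[OF Z assms(2) that] IH[OF that] by blast
  moreover have "\<exists>a\<in>elems \<sigma>. sat \<sigma> (v(x := a)) \<phi> \<longleftrightarrow> sat \<tau> (w(x := b)) \<phi>"
    if b: "b \<in> elems \<tau>" for b
  proof -
    obtain a where a: "a \<in> elems \<sigma>"
      "near_set (quantifier_rank \<phi>) (position \<tau> mid' \<sigma> mid (w(x := b)) (v(x := a)))"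
      using position_forth[OF Z' assms(1) b] by blast
    then have "near_set (quantifier_rank \<phi>) (position \<sigma> mid \<tau> mid' (v(x := a)) (w(x := b)))"
      by (metis near_set_converse position_converse)
    then show ?thesis using IH[OF a(1) b] a(1) by blast
  qed
  ultimately show ?case unfolding sat.simps by blast
qed

text \<open>Only two pairs are added to the anchors because \<open>sat2\<close> gives every variable
  other than \<open>0\<close> the value of the second element.\<close>

lemma sat2_cong_position:
  assumes "mid \<in> {1..fst \<sigma> + 1}" "mid' \<in> {1..fst \<tau> + 1}" "same_values \<sigma> mid \<tau> mid'"
    and "near_set (quantifier_rank \<phi>) (anchors \<sigma> mid \<tau> mid' \<union>
      {(coord mid a, coord mid' a'), (coord mid b, coord mid' b')})"
    and "a \<in> elems \<sigma>" "b \<in> elems \<sigma>" "a' \<in> elems \<tau>" "b' \<in> elems \<tau>"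
  shows "sat2 \<sigma> a b \<phi> \<longleftrightarrow> sat2 \<tau> a' b' \<phi>"
  unfolding sat2_def
proof (rule sat_cong_position[OF assms(1-3)])
  show "near_set (quantifier_rank \<phi>)
      (position \<sigma> mid \<tau> mid' ((\<lambda>_. b)(0 := a)) ((\<lambda>_. b')(0 := a')))"
    by (rule near_set_subset[OF assms(4)]) (auto simp: position_def)
qed (use assms(5-8) in auto)

lemma near_set_insert:
  "near_set r (insert (c, d) Z) \<longleftrightarrow> near_set r Z \<and> (\<forall>(p, q)\<in>Z. near r (c - p) (d - q))"
proof -
  have "near r (c - p) (d - q) \<longleftrightarrow> near r (p - c) (q - d)" for p q
    using near_uminus[of r "c - p" "d - q"] by simp
  then show ?thesis by (auto simp: near_set_def)
qed

lemma near_set_empty [simp]: "near_set r {}"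
  by (simp add: near_set_def)

section \<open>Two families without a defining formula\<close>

lemma not_definable_delta:
  obtains k where "k \<ge> 2"
    "\<not> (\<forall>a\<in>elems (delta k). \<forall>b\<in>elems (delta k).
        sat2 (delta k) a b \<phi> \<longleftrightarrow> is_transposition (delta k) a b)"
proof -
  define e :: nat where "e = 2 ^ quantifier_rank \<phi>"
  have e: "e \<ge> 1" by (simp add: e_def)
  have pow: "(2::int) ^ quantifier_rank \<phi> = int e" by (simp add: e_def)
  define k where "k = 4 * e + 4"
  \<comment> \<open>The element \<open>?b'\<close> is the one right after \<open>?b\<close>. This
    \<open>i\<close> leaves its coordinate exactly \<open>e\<close> below the upper sentinel, and
    \<open>k\<close> keeps \<open>?a\<close> and \<open>?b\<close> more than \<open>e\<close> apart,
    so every distance changed by the shift stays at least \<open>e\<close>.\<close>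
  define i where "i = e + 1"
  let ?\<sigma> = "delta k"
  let ?a = "(i, k + 1 - i)" and ?b = "(k + 1 - i, i)" and ?b' = "(k + 2 - i, i - 1)"
  have el: "?a \<in> elems ?\<sigma>" "?b \<in> elems ?\<sigma>" "?b' \<in> elems ?\<sigma>"
    using e by (auto simp: elems_def delta_def k_def i_def)
  have "same_values ?\<sigma> 1 ?\<sigma> 1"
    by (auto simp: same_values_def elems_def delta_def)
  moreover have "near_set (quantifier_rank \<phi>) (anchors ?\<sigma> 1 ?\<sigma> 1 \<union>
      {(coord 1 ?a, coord 1 ?a), (coord 1 ?b, coord 1 ?b')})"
    using e by (auto simp: anchors_def near_set_insert near_def pow coord_def delta_def k_def i_def)
  ultimately have "sat2 ?\<sigma> ?a ?b \<phi> \<longleftrightarrow> sat2 ?\<sigma> ?a ?b' \<phi>"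
    using el by (intro sat2_cong_position) auto
  moreover have "is_transposition ?\<sigma> ?a ?b"
    by (auto simp: is_transposition_def delta_def k_def i_def)
  moreover have "\<not> is_transposition ?\<sigma> ?a ?b'"
    by (auto simp: is_transposition_def delta_def k_def i_def)
  ultimately show ?thesis using el that[of k] by (auto simp: k_def)
qed

lemma not_definable_iota_skew_sum_iota:
  obtains m n n' where "m \<ge> 1" "n \<ge> 1" "n' \<ge> 1"
    "\<not> (\<forall>\<sigma>\<in>{iota m \<ominus> iota n, iota m \<ominus> iota n'}. \<forall>a\<in>elems \<sigma>. \<forall>b\<in>elems \<sigma>.
        sat2 \<sigma> a b \<phi> \<longleftrightarrow> is_transposition \<sigma> a b)"
proof -
  define n :: nat where "n = 2 ^ quantifier_rank \<phi>"
  have n: "n \<ge> 1" by (simp add: n_def)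
  have pow: "(2::int) ^ quantifier_rank \<phi> = int n" by (simp add: n_def)
  let ?\<sigma> = "iota n \<ominus> iota n" and ?\<tau> = "iota n \<ominus> iota (Suc n)"
  \<comment> \<open>Only the distances to the upper sentinel differ between the two permutations;
    the smallest, from \<open>?b\<close>, is \<open>n\<close> against \<open>n + 1\<close>. The
    longer second block raises the value at position \<open>1\<close> to \<open>n + 2\<close>, which
    is not the position of \<open>?b\<close>.\<close>
  let ?a = "(1, n + 1)" and ?a' = "(1, n + 2)" and ?b = "(n + 1, 1)"
  have el: "?a \<in> elems ?\<sigma>" "?b \<in> elems ?\<sigma>" "?a' \<in> elems ?\<tau>" "?b \<in> elems ?\<tau>"
    using n by (auto simp: elems_def skew_sum_def iota_def)
  have "same_values ?\<sigma> (n + 1) ?\<tau> (n + 1)"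
    unfolding same_values_def
    by (auto simp: elems_def skew_sum_def iota_def split: if_splits)
  moreover have "near_set (quantifier_rank \<phi>) (anchors ?\<sigma> (n + 1) ?\<tau> (n + 1) \<union>
      {(coord (n + 1) ?a, coord (n + 1) ?a'), (coord (n + 1) ?b, coord (n + 1) ?b)})"
    using n by (auto simp: anchors_def near_set_insert near_def pow coord_def skew_sum_def iota_def)
  ultimately have "sat2 ?\<sigma> ?a ?b \<phi> \<longleftrightarrow> sat2 ?\<tau> ?a' ?b \<phi>"
    using el by (intro sat2_cong_position) (auto simp: skew_sum_def iota_def)
  moreover have "is_transposition ?\<sigma> ?a ?b"
    using n by (auto simp: is_transposition_def skew_sum_def iota_def)
  moreover have "\<not> is_transposition ?\<tau> ?a' ?b"
    by (auto simp: is_transposition_def skew_sum_def iota_def)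
  ultimately have "\<not> (\<forall>\<rho>\<in>{?\<sigma>, ?\<tau>}. \<forall>a\<in>elems \<rho>. \<forall>b\<in>elems \<rho>.
      sat2 \<rho> a b \<phi> \<longleftrightarrow> is_transposition \<rho> a b)"
    using el by blast
  then show ?thesis using n that[of n n "Suc n"] by auto
qed

theorem theorem5p7:
  fixes C :: "perm set"
  assumes "perm_class C"
  shows "(\<exists>\<phi>. binary_formula \<phi> \<and>
            (\<forall>\<sigma>\<in>C. \<forall>a\<in>elems \<sigma>. \<forall>b\<in>elems \<sigma>.
              sat2 \<sigma> a b \<phi> \<longleftrightarrow> is_transposition \<sigma> a b))
    \<longleftrightarrow> (\<exists>k m n. k \<ge> 2 \<and> m \<ge> 1 \<and> n \<ge> 1 \<and>
            delta k \<notin> C \<and> iota m \<ominus> iota n \<notin> C)"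
    (is "?definable \<longleftrightarrow> ?avoids")
proof
  assume ?definable
  then obtain \<phi> where \<phi>: "\<And>\<sigma> a b. \<sigma> \<in> C \<Longrightarrow> a \<in> elems \<sigma> \<Longrightarrow> b \<in> elems \<sigma> \<Longrightarrow>
      sat2 \<sigma> a b \<phi> \<longleftrightarrow> is_transposition \<sigma> a b"
    by blast
  obtain k where k: "k \<ge> 2" "delta k \<notin> C"
    by (rule not_definable_delta[of \<phi>]) (use \<phi> in blast)
  \<comment> \<open>The formula would be correct on both permutations if \<open>C\<close> contained
    them, so at least one is missing; either supplies the required pair of lengths.\<close>
  obtain m n n' where *: "m \<ge> 1" "n \<ge> 1" "n' \<ge> 1"
    "\<not> {iota m \<ominus> iota n, iota m \<ominus> iota n'} \<subseteq> C"
    by (rule not_definable_iota_skew_sum_iota[of \<phi>]) (use \<phi> in blast)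
  then have "iota m \<ominus> iota n \<notin> C \<or> iota m \<ominus> iota n' \<notin> C" by blast
  then show ?avoids using k * by blast
next
  assume ?avoids
  then show ?definable using transposition_formula[OF assms] by blast
qed

end
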